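(* Consider the biobjective integer program "$\min$" $\{z(x)=(z_1(x),z_2(x))^T : x\in\mathcal{X}\subseteq\mathbb{Z}^n\}$ with integer-valued objectives $z_1,z_2$. Let $d\in\mathbb{R}^2_+\setminus\{0\}$ (i.e. $d\ge 0$ componentwise, $d\neq 0$) and $0<\epsilon<1$. Then Algorithm 1 (described in the context) works correctly: it returns the set of all nondominated points of the problem.
   Context: Problem. $\mathcal{X}\subseteq\mathbb{Z}^n$ is the feasible set, $z_1,z_2:\mathcal{X}\to\mathbb{Z}$ are integer-valued, and $\mathcal{Z}=\{z(x):x\in\mathcal{X}\}$. It is implicitly assumed that $\mathcal{X}\ne\emptyset$ and that the two lexicographic problems below have optimal solutions. For vectors in $\mathbb{R}^2$, $\le$ is componentwise. A point $z(x)\in\mathcal{Z}$ is nondominated if there is no $x'\in\mathcal{X}$ with $z(x')\le z(x)$ and $z(x')\ne z(x)$. $\text{lexmin}\{z_i(x),z_j(x): x\in\mathcal{X}\}$ means: first solve $\min\{z_i(x):x\in\mathcal{X}\}$ with optimal solution $x'$, then solve $\min\{z_j(x):x\in\mathcal{X},\ z_i(x)=z_i(x')\}$. A box is given by three points $s,p,t\in\mathbb{R}^2$ and is denoted $b(s,p,t)$ (as a set it is $\{y\in\mathbb{R}^2: s_1\le y_1\le p_1,\ s_2\le y_2\le t_2\}$). For a box $b=b(s^b,p^b,t^b)$, problem $R(b,d)$ is $$\min\{\alpha : x\in\mathcal{X},\ \alpha\in\mathbb{R},\ z(x)\le s^b+\alpha d,\ z_1(x)\le p_1^b-\epsilon,\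 z_2(x)\le t_2^b-\epsilon\}.$$ Problem $P_1(x^b)$ is $\min\{z_2(x):x\in\mathcal{X},\ z_1(x)=z_1(x^b)\}$; problem $P_2(x^b)$ is $\min\{z_1(x):x\in\mathcal{X},\ z_2(x)=z_2(x^b)\}$. Algorithm 1. Fix the direction $d$ and $0<\epsilon<1$. Initialization: let $t^0$ be the objective vector of a solution of $\text{lexmin}\{z_1(x),z_2(x):x\in\mathcal{X}\}$ and $p^0$ that of $\text{lexmin}\{z_2(x),z_1(x):x\in\mathcal{X}\}$. Set the output list $\mathcal{N}=\{t^0,p^0\}$, $s^0=(t^0_1,p^0_2)^T$, $\mathcal{B}=\{b(s^0,p^0,t^0)\}$. Main loop: while $\mathcal{B}\neq\emptyset$, pick a box $b=b(s^b,p^b,t^b)\in\mathcal{B}$ and solve $R(b,d)$. If $R(b,d)$ is feasible, let $(\alpha^b,x^b)$ be an optimal solution and do the following. (1) Set $y^b=s^b+\alpha^b d$ and $n^b=z(x^b)$. (2) If $y^b_1=n^b_1$, solve $P_1(x^b)$, let $x^1$ be an optimal solution and set $n^1=z(x^1)$; otherwise set $n^1=n^b$. (3) If $y^b_2=n^b_2$, solve $P_2(x^b)$, let $x^2$ be an optimal solution and set $n^2=z(x^2)$; otherwise set $n^2=n^b$. (4) If $n^1_2<n^b_2$, add $n^1$ to $\mathcal{N}$. If $n^2_1<n^b_1$, add $n^2$ to $\mathcal{N}$. If $n^1_2\ge n^b_2$ and $n^2_1\ge n^b_1$, add $n^b$ to $\mathcal{N}$. (5) Set $s^1=(n^1_1,p^b_2)^T$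 and $s^2=(t^b_1,n^2_2)^T$. (6) If $p^b_1-s^1_1>1$ and $n^1_2-s^1_2>1$, add the box $b(s^1,p^b,n^1)$ to $\mathcal{B}$. If $n^2_1-s^2_1>1$ and $t^b_2-s^2_2>1$, add the box $b(s^2,n^2,t^b)$ to $\mathcal{B}$. In all cases (feasible or not), finally remove $b(s^b,p^b,t^b)$ from $\mathcal{B}$. When $\mathcal{B}$ is empty, return $\mathcal{N}$.
   Formalization: Both components of d are assumed nonzero (so d is strictly positive); if a component of d is zero, R(b,d) is infeasible on the initial box and only t^0 and p^0 are returned, so the claim fails, e.g. for X={0,1,2}, z(x)=(x,2-x), d=(0,1). *)

theory Defs
  imports "HOL-Analysis.Analysis"
begin

text \<open>
  Throughout, \<open>X\<close> is the feasible set and \<open>z1\<close>, \<open>z2\<close> are the objectives; only their values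
  on \<open>X\<close> matter.  The order on \<open>real ^ 2\<close> is the componentwise one of the library.
\<close>

definition objective_vector :: "('x \<Rightarrow> int) \<Rightarrow> ('x \<Rightarrow> int) \<Rightarrow> 'x \<Rightarrow> real ^ 2" where
  "objective_vector z1 z2 x = vector [real_of_int (z1 x), real_of_int (z2 x)]"

definition nondominated_points ::
    "'x set \<Rightarrow> ('x \<Rightarrow> int) \<Rightarrow> ('x \<Rightarrow> int) \<Rightarrow> (real ^ 2) set" where
  "nondominated_points X z1 z2 =
     {objective_vector z1 z2 x | x. x \<in> X \<and>
        \<not> (\<exists>x'\<in>X. objective_vector z1 z2 x' \<le> objective_vector z1 z2 x \<and>
                   objective_vector z1 z2 x' \<noteq> objective_vector z1 z2 x)}"

definition lexmin_solution ::
    "'x set \<Rightarrow> ('x \<Rightarrow> int) \<Rightarrow> ('x \<Rightarrow> int) \<Rightarrow> 'x \<Rightarrow> bool" where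
  "lexmin_solution X f g x \<longleftrightarrow>
     (\<exists>x'. is_arg_min f (\<lambda>u. u \<in> X) x' \<and>
           is_arg_min g (\<lambda>u. u \<in> X \<and> f u = f x') x)"

text \<open>
  \<open>Box s p t\<close> is the triple describing
  \<open>{y. s $ 1 \<le> y $ 1 \<and> y $ 1 \<le> p $ 1 \<and> s $ 2 \<le> y $ 2 \<and> y $ 2 \<le> t $ 2}\<close>.
\<close>

datatype box = Box (s_pt: "real ^ 2") (p_pt: "real ^ 2") (t_pt: "real ^ 2")

definition R_feasible ::
    "'x set \<Rightarrow> ('x \<Rightarrow> int) \<Rightarrow> ('x \<Rightarrow> int) \<Rightarrow> real ^ 2 \<Rightarrow> real \<Rightarrow> box \<Rightarrow> real \<times> 'x \<Rightarrow> bool" where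
  "R_feasible X z1 z2 d \<epsilon> b = (\<lambda>(\<alpha>, x). x \<in> X \<and>
     objective_vector z1 z2 x \<le> s_pt b + \<alpha> *\<^sub>R d \<and>
     real_of_int (z1 x) \<le> p_pt b $ 1 - \<epsilon> \<and>
     real_of_int (z2 x) \<le> t_pt b $ 2 - \<epsilon>)"

definition R_optimal ::
    "'x set \<Rightarrow> ('x \<Rightarrow> int) \<Rightarrow> ('x \<Rightarrow> int) \<Rightarrow> real ^ 2 \<Rightarrow> real \<Rightarrow> box \<Rightarrow> real \<times> 'x \<Rightarrow> bool" where
  "R_optimal X z1 z2 d \<epsilon> b = is_arg_min fst (R_feasible X z1 z2 d \<epsilon> b)"

definition P1_optimal ::
    "'x set \<Rightarrow> ('x \<Rightarrow> int) \<Rightarrow> ('x \<Rightarrow> int) \<Rightarrow> 'x \<Rightarrow> 'x \<Rightarrow> bool" where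
  "P1_optimal X z1 z2 xb = is_arg_min z2 (\<lambda>x. x \<in> X \<and> z1 x = z1 xb)"

definition P2_optimal ::
    "'x set \<Rightarrow> ('x \<Rightarrow> int) \<Rightarrow> ('x \<Rightarrow> int) \<Rightarrow> 'x \<Rightarrow> 'x \<Rightarrow> bool" where
  "P2_optimal X z1 z2 xb = is_arg_min z1 (\<lambda>x. x \<in> X \<and> z2 x = z2 xb)"

text \<open>
  A state is a pair of the output collected so far and the set of boxes still to be explored.
  The choices of the box and of optimal solutions of the subproblems are nondeterministic,
  so the algorithm is a transition relation on states.
\<close>

type_synonym state = "(real ^ 2) set \<times> box set"

definition initial_state :: "'x set \<Rightarrow> ('x \<Rightarrow> int) \<Rightarrow> ('x \<Rightarrow> int) \<Rightarrow> state \<Rightarrow> bool" where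
  "initial_state X z1 z2 S \<longleftrightarrow>
     (\<exists>xt xp. lexmin_solution X z1 z2 xt \<and> lexmin_solution X z2 z1 xp \<and>
        (let t0 = objective_vector z1 z2 xt;
             p0 = objective_vector z1 z2 xp;
             s0 = vector [t0 $ 1, p0 $ 2]
         in S = ({t0, p0}, {Box s0 p0 t0})))"

definition new_points :: "real ^ 2 \<Rightarrow> real ^ 2 \<Rightarrow> real ^ 2 \<Rightarrow> (real ^ 2) set" where
  "new_points n n1 n2 =
     (if n1 $ 2 < n $ 2 then {n1} else {}) \<union>
     (if n2 $ 1 < n $ 1 then {n2} else {}) \<union>
     (if n1 $ 2 \<ge> n $ 2 \<and> n2 $ 1 \<ge> n $ 1 then {n} else {})"

definition new_boxes :: "box \<Rightarrow> real ^ 2 \<Rightarrow> real ^ 2 \<Rightarrow> box set" where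
  "new_boxes b n1 n2 =
     (let s1 = vector [n1 $ 1, p_pt b $ 2];
          s2 = vector [t_pt b $ 1, n2 $ 2]
      in (if p_pt b $ 1 - s1 $ 1 > 1 \<and> n1 $ 2 - s1 $ 2 > 1
          then {Box s1 (p_pt b) n1} else {}) \<union>
         (if n2 $ 1 - s2 $ 1 > 1 \<and> t_pt b $ 2 - s2 $ 2 > 1
          then {Box s2 n2 (t_pt b)} else {}))"

inductive step ::
    "'x set \<Rightarrow> ('x \<Rightarrow> int) \<Rightarrow> ('x \<Rightarrow> int) \<Rightarrow> real ^ 2 \<Rightarrow> real \<Rightarrow> state \<Rightarrow> state \<Rightarrow> bool"
  for X z1 z2 d \<epsilon> where
  infeasible:
    "\<lbrakk> b \<in> B; \<not> (\<exists>q. R_feasible X z1 z2 d \<epsilon> b q) \<rbrakk>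
     \<Longrightarrow> step X z1 z2 d \<epsilon> (N, B) (N, B - {b})"
| feasible:
    "\<lbrakk> b \<in> B; R_optimal X z1 z2 d \<epsilon> b (\<alpha>, xb);
       y = s_pt b + \<alpha> *\<^sub>R d; n = objective_vector z1 z2 xb;
       if y $ 1 = n $ 1
         then \<exists>x1. P1_optimal X z1 z2 xb x1 \<and> n1 = objective_vector z1 z2 x1
         else n1 = n;
       if y $ 2 = n $ 2
         then \<exists>x2. P2_optimal X z1 z2 xb x2 \<and> n2 = objective_vector z1 z2 x2
         else n2 = n \<rbrakk>
     \<Longrightarrow> step X z1 z2 d \<epsilon> (N, B) (N \<union> new_points n n1 n2, (B \<union> new_boxes b n1 n2) - {b})"

definition reachable ::
    "'x set \<Rightarrow> ('x \<Rightarrow> int) \<Rightarrow> ('x \<Rightarrow> int) \<Rightarrow> real ^ 2 \<Rightarrow> real \<Rightarrow> state \<Rightarrow> bool" where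
  "reachable X z1 z2 d \<epsilon> S \<longleftrightarrow>
     (\<exists>S0. initial_state X z1 z2 S0 \<and> (step X z1 z2 d \<epsilon>)\<^sup>*\<^sup>* S0 S)"

definition returns ::
    "'x set \<Rightarrow> ('x \<Rightarrow> int) \<Rightarrow> ('x \<Rightarrow> int) \<Rightarrow> real ^ 2 \<Rightarrow> real \<Rightarrow> (real ^ 2) set \<Rightarrow> bool" where
  "returns X z1 z2 d \<epsilon> N \<longleftrightarrow> reachable X z1 z2 d \<epsilon> (N, {})"

definition terminates ::
    "'x set \<Rightarrow> ('x \<Rightarrow> int) \<Rightarrow> ('x \<Rightarrow> int) \<Rightarrow> real ^ 2 \<Rightarrow> real \<Rightarrow> bool" where
  "terminates X z1 z2 d \<epsilon> \<longleftrightarrow>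
     \<not> (\<exists>\<sigma> :: nat \<Rightarrow> state. initial_state X z1 z2 (\<sigma> 0) \<and>
          (\<forall>k. step X z1 z2 d \<epsilon> (\<sigma> k) (\<sigma> (Suc k))))"

text \<open>
  Every subproblem that a run can ask for has an optimal solution, whatever choices were made
  before; hence no run gets stuck while there are boxes left.
\<close>

definition subproblems_solvable ::
    "'x set \<Rightarrow> ('x \<Rightarrow> int) \<Rightarrow> ('x \<Rightarrow> int) \<Rightarrow> real ^ 2 \<Rightarrow> real \<Rightarrow> bool" where
  "subproblems_solvable X z1 z2 d \<epsilon> \<longleftrightarrow>
     (\<forall>N B b. reachable X z1 z2 d \<epsilon> (N, B) \<longrightarrow> b \<in> B \<longrightarrow>
        ((\<exists>q. R_feasible X z1 z2 d \<epsilon> b q) \<longrightarrow> (\<exists>q. R_optimal X z1 z2 d \<epsilon> b q)) \<and>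
        (\<forall>\<alpha> xb. R_optimal X z1 z2 d \<epsilon> b (\<alpha>, xb) \<longrightarrow>
           ((s_pt b + \<alpha> *\<^sub>R d) $ 1 = objective_vector z1 z2 xb $ 1 \<longrightarrow>
              (\<exists>x1. P1_optimal X z1 z2 xb x1)) \<and>
           ((s_pt b + \<alpha> *\<^sub>R d) $ 2 = objective_vector z1 z2 xb $ 2 \<longrightarrow>
              (\<exists>x2. P2_optimal X z1 z2 xb x2))))"

text \<open>
  Total correctness: no infinite run, no stuck run, some run returns, and every run that
  returns yields the nondominated set.
\<close>

definition works_correctly ::
    "'x set \<Rightarrow> ('x \<Rightarrow> int) \<Rightarrow> ('x \<Rightarrow> int) \<Rightarrow> real ^ 2 \<Rightarrow> real \<Rightarrow> bool" where
  "works_correctly X z1 z2 d \<epsilon> \<longleftrightarrow>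
     terminates X z1 z2 d \<epsilon> \<and>
     subproblems_solvable X z1 z2 d \<epsilon> \<and>
     (\<exists>N. returns X z1 z2 d \<epsilon> N) \<and>
     (\<forall>N. returns X z1 z2 d \<epsilon> N \<longrightarrow> N = nondominated_points X z1 z2)"

end

theory Submission
  imports Defs
begin

text \<open>
  Every box met by a run is spanned by two image points: no feasible image lies weakly to the left
  of \<open>t\<close> and strictly below it, nor weakly below \<open>p\<close> and strictly to its left.  Since both
  components of \<open>d\<close> are positive, no image bounded by \<open>n\<close> lies strictly below the optimal reference
  point \<open>y\<close> of \<open>R(b,d)\<close> in both coordinates; hence \<open>n\<^sup>1\<close> and \<open>n\<^sup>2\<close> again have these two properties,
  and each nondominated point in the open box is one of the new points or lies in one of the two new
  open boxes.  Both new boxes are strictly narrower than the old one, so \<open>\<Sum>b\<in>B. 3 ^ width b\<close>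
  decreases.
\<close>

section \<open>Nondominance in two halves, and existence of minimisers\<close>

text \<open>One half of nondominance. A box corner needs only one half: \<open>n1\<close> may be
  dominated by a point at the same height further to the left.\<close>

definition lowest :: "'x set \<Rightarrow> ('x \<Rightarrow> int) \<Rightarrow> ('x \<Rightarrow> int) \<Rightarrow> 'x \<Rightarrow> bool" where
  "lowest X f g x \<longleftrightarrow> x \<in> X \<and> (\<forall>u\<in>X. f u \<le> f x \<longrightarrow> g x \<le> g u)"

lemma lowestD: "lowest X f g x \<Longrightarrow> u \<in> X \<Longrightarrow> f u \<le> f x \<Longrightarrow> g x \<le> g u"
  by (auto simp: lowest_def)

lemma lowest_in: "lowest X f g x \<Longrightarrow> x \<in> X"
  by (auto simp: lowest_def)

lemma objective_vector_nth [simp]: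
  "objective_vector z1 z2 x $ 1 = real_of_int (z1 x)"
  "objective_vector z1 z2 x $ 2 = real_of_int (z2 x)"
  by (simp_all add: objective_vector_def)

lemma objective_vector_eq_iff:
  "objective_vector z1 z2 x = objective_vector z1 z2 u \<longleftrightarrow> z1 x = z1 u \<and> z2 x = z2 u"
  by (simp add: vec_eq_iff forall_2)

lemma objective_vector_le_iff:
  "objective_vector z1 z2 x \<le> objective_vector z1 z2 u \<longleftrightarrow> z1 x \<le> z1 u \<and> z2 x \<le> z2 u"
  by (simp add: less_eq_vec_def forall_2)

text \<open>A dominating point is strictly smaller in some coordinate, and that coordinate tells
  which of the two halves it violates.\<close>

lemma nondominated_points_eq_lowest:
  "nondominated_points X z1 z2 =
     objective_vector z1 z2 ` {x. lowest X z1 z2 x \<and> lowest X z2 z1 x}"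
proof -
  have "x \<in> X \<and> \<not> (\<exists>u\<in>X. (z1 u \<le> z1 x \<and> z2 u \<le> z2 x) \<and> \<not> (z1 u = z1 x \<and> z2 u = z2 x)) \<longleftrightarrow>
      lowest X z1 z2 x \<and> lowest X z2 z1 x" for x
    unfolding lowest_def by (metis linorder_le_cases order_antisym)
  then show ?thesis
    unfolding nondominated_points_def objective_vector_eq_iff objective_vector_le_iff
    by (auto simp: image_def)
qed

lemma lexmin_solution_iff:
  "lexmin_solution X f g x \<longleftrightarrow>
     x \<in> X \<and> (\<forall>u\<in>X. f x \<le> f u) \<and> (\<forall>u\<in>X. f u = f x \<longrightarrow> g x \<le> g u)"
  unfolding lexmin_solution_def is_arg_min_linorder
  by (metis order.refl)

lemma lexmin_solution_lowest:
  assumes "lexmin_solution X f g x"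
  shows "lowest X f g x" "lowest X g f x"
  using assms unfolding lexmin_solution_iff lowest_def by (meson order_antisym)+

lemma ex_is_arg_min_int:
  fixes f :: "'a \<Rightarrow> int"
  assumes "P a" and lb: "\<And>x. P x \<Longrightarrow> c \<le> f x"
  shows "\<exists>x. is_arg_min f P x"
proof -
  obtain x where "P x" and least: "\<And>y. P y \<Longrightarrow> nat (f x - c) \<le> nat (f y - c)"
    using ex_has_least_nat[of P a "\<lambda>x. nat (f x - c)"] \<open>P a\<close> by blast
  have "f x \<le> f y" if "P y" for y
    using least[OF that] lb[OF that] lb[OF \<open>P x\<close>] by linarith
  then show ?thesis
    using \<open>P x\<close> by (auto simp: is_arg_min_linorder)
qed

lemma ex_is_arg_min_finite_image:
  fixes f :: "'a \<Rightarrow> 'b::linorder"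
  assumes "P a" and fin: "finite (f ` Collect P)"
  shows "\<exists>x. is_arg_min f P x"
proof -
  have "Min (f ` Collect P) \<in> f ` Collect P"
    using \<open>P a\<close> by (intro Min_in[OF fin]) blast
  then obtain x where "P x" "f x = Min (f ` Collect P)" by auto
  then show ?thesis
    using fin by (auto simp: is_arg_min_linorder intro!: exI[of _ x])
qed

text \<open>Yields \<open>m1\<close> and, with the objectives swapped, \<open>m2\<close>; here
  \<open>a\<close> and \<open>b\<close> are the coordinates of the reference point \<open>y\<close>.
  A feasible \<open>x\<close> refuting the minimality of \<open>m\<close> has
  \<open>g x < b\<close>, so \<open>below\<close> forces \<open>f x = f n = a\<close>, which is the
  case in which the subproblem has minimised \<open>g\<close> on that line.\<close>

lemma lowest_of_optimal:
  fixes a b :: real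
  assumes n: "n \<in> X" "f n \<le> a" "g n \<le> b"
    and below: "\<And>x. x \<in> X \<Longrightarrow> f x \<le> f n \<Longrightarrow> g x \<le> g n \<Longrightarrow> \<not> (f x < a \<and> g x < b)"
    and m: "m \<in> X" "f m = f n" "g m \<le> g n"
    and opt: "a = f n \<Longrightarrow> \<forall>x\<in>X. f x = f n \<longrightarrow> g m \<le> g x"
  shows "lowest X f g m"
  unfolding lowest_def
proof (intro conjI ballI impI)
  fix x assume x: "x \<in> X" "f x \<le> f m"
  show "g m \<le> g x"
  proof (rule ccontr)
    assume "\<not> g m \<le> g x"
    with m n have *: "g x \<le> g n" "g x < b" by auto
    with below[OF x(1)] x(2) m(2) have "\<not> f x < a" by auto
    with x(2) m(2) n(2) have "f x = f n" "a = f n" by auto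
    with opt x(1) \<open>\<not> g m \<le> g x\<close> show False by auto
  qed
qed fact

section \<open>Boxes spanned by image points, and the termination measure\<close>

text \<open>Naming preimages of the corners keeps the arithmetic in the integers. A box determines
  the images of \<open>xt\<close> and \<open>xp\<close>, but not the preimages themselves.\<close>

definition corner_box :: "('x \<Rightarrow> int) \<Rightarrow> ('x \<Rightarrow> int) \<Rightarrow> 'x \<Rightarrow> 'x \<Rightarrow> box" where
  "corner_box z1 z2 xt xp =
     Box (vector [real_of_int (z1 xt), real_of_int (z2 xp)])
       (objective_vector z1 z2 xp) (objective_vector z1 z2 xt)"

lemma corner_box_sel [simp]:
  "s_pt (corner_box z1 z2 xt xp) = vector [real_of_int (z1 xt), real_of_int (z2 xp)]"
  "p_pt (corner_box z1 z2 xt xp) = objective_vector z1 z2 xp"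
  "t_pt (corner_box z1 z2 xt xp) = objective_vector z1 z2 xt"
  by (simp_all add: corner_box_def)

lemma corner_box_eq_iff:
  "corner_box z1 z2 xt xp = corner_box z1 z2 ut up \<longleftrightarrow>
     z1 xt = z1 ut \<and> z2 xt = z2 ut \<and> z1 xp = z1 up \<and> z2 xp = z2 up"
  by (auto simp: corner_box_def objective_vector_eq_iff)

lemma new_boxes_corner_box:
  assumes "z1 m1 = z1 n" "z2 m2 = z2 n"
  shows "new_boxes (corner_box z1 z2 xt xp) (objective_vector z1 z2 m1) (objective_vector z1 z2 m2) =
     (if z1 xp - z1 n > 1 \<and> z2 m1 - z2 xp > 1 then {corner_box z1 z2 m1 xp} else {}) \<union>
     (if z1 m2 - z1 xt > 1 \<and> z2 xt - z2 n > 1 then {corner_box z1 z2 xt m2} else {})"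
proof -
  have "(1::real) < real_of_int a - real_of_int b \<longleftrightarrow> 1 < a - b" for a b :: int
    by linarith
  then show ?thesis
    using assms by (simp add: new_boxes_def Let_def corner_box_def)
qed

lemma new_points_objective_vector:
  "new_points (objective_vector z1 z2 n) (objective_vector z1 z2 m1) (objective_vector z1 z2 m2) =
     (if z2 m1 < z2 n then {objective_vector z1 z2 m1} else {}) \<union>
     (if z1 m2 < z1 n then {objective_vector z1 z2 m2} else {}) \<union>
     (if z2 m1 \<ge> z2 n \<and> z1 m2 \<ge> z1 n then {objective_vector z1 z2 n} else {})"
  by (simp add: new_points_def)

definition width :: "box \<Rightarrow> nat" where
  "width b = nat \<lfloor>p_pt b $ 1 - t_pt b $ 1\<rfloor>"

lemma width_corner_box [simp]: "width (corner_box z1 z2 xt xp) = nat (z1 xp - z1 xt)"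
  by (simp add: width_def flip: of_int_diff)

text \<open>Base 3 makes two boxes of width \<open>w\<close> weigh less than one of width
  \<open>Suc w\<close>. Even a box of width 0 has positive weight, so discarding it counts as
  progress.\<close>

definition weight :: "box set \<Rightarrow> nat" where
  "weight B = (\<Sum>b\<in>B. 3 ^ width b)"

lemma weight_remove:
  assumes "finite B" "b \<in> B"
  shows "weight B = 3 ^ width b + weight (B - {b})"
  unfolding weight_def using assms by (rule sum.remove)

text \<open>Only an inequality, since a new box may already be waiting in the set.\<close>

lemma weight_Un_le: "finite A \<Longrightarrow> finite B \<Longrightarrow> weight (A \<union> B) \<le> weight A + weight B"
  unfolding weight_def by (simp add: sum_Un_nat)

section \<open>Splitting the interior of a box\<close>

definition in_open_box :: "('x \<Rightarrow> int) \<Rightarrow> ('x \<Rightarrow> int) \<Rightarrow> 'x \<Rightarrow> 'x \<Rightarrow> 'x \<Rightarrow> bool" where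
  "in_open_box z1 z2 xt xp x \<longleftrightarrow> z1 xt < z1 x \<and> z1 x < z1 xp \<and> z2 xp < z2 x \<and> z2 x < z2 xt"

text \<open>\<open>m1\<close> and \<open>m2\<close> stand for the preimages of \<open>n\<^sup>1\<close> and \<open>n\<^sup>2\<close>, also when no subproblem is solved.\<close>

definition splits :: "'x set \<Rightarrow> ('x \<Rightarrow> int) \<Rightarrow> ('x \<Rightarrow> int) \<Rightarrow> 'x \<Rightarrow> 'x \<Rightarrow> 'x \<Rightarrow> bool" where
  "splits X z1 z2 n m1 m2 \<longleftrightarrow> n \<in> X \<and> lowest X z1 z2 m1 \<and> lowest X z2 z1 m2 \<and>
     z1 m1 = z1 n \<and> z2 m1 \<le> z2 n \<and> z2 m2 = z2 n \<and> z1 m2 \<le> z1 n \<and>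
     (\<forall>x\<in>X. \<not> (z1 x < z1 n \<and> z2 x < z2 n))"

text \<open>Strictly below \<open>n\<close>, no image lies strictly left of \<open>n\<close>. So if
  \<open>m1\<close> is strictly below \<open>n\<close>, nothing weakly below \<open>m1\<close> is to
  its left; \<open>m2\<close> is symmetric. If neither improves on \<open>n\<close>, all three share
  one image, which inherits both halves.\<close>

lemma new_points_nondominated:
  assumes "splits X z1 z2 n m1 m2"
  shows "new_points (objective_vector z1 z2 n) (objective_vector z1 z2 m1) (objective_vector z1 z2 m2)
    \<subseteq> nondominated_points X z1 z2"
proof -
  have 1: "lowest X z2 z1 m1" if "z2 m1 < z2 n"
    using assms that unfolding splits_def lowest_def by force
  have 2: "lowest X z1 z2 m2" if "z1 m2 < z1 n"
    using assms that unfolding splits_def lowest_def by force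
  have 3: "lowest X z1 z2 n \<and> lowest X z2 z1 n" if "z2 m1 \<ge> z2 n" "z1 m2 \<ge> z1 n"
    using assms that unfolding splits_def lowest_def by auto
  show ?thesis
    unfolding new_points_objective_vector nondominated_points_eq_lowest
    using 1 2 3 assms unfolding splits_def by auto
qed

text \<open>As \<open>v\<close> is not strictly below and left of \<open>n\<close>, it lies right of
  \<open>n\<close>, above \<open>n\<close>, or on the ray going down or left from \<open>n\<close>.
  In the first two cases, comparing \<open>v\<close> with \<open>m1\<close> or \<open>m2\<close>
  supplies the missing bound for a new box; on a ray, \<open>v\<close> has the image of
  \<open>m1\<close> or \<open>m2\<close>.\<close>

lemma nondominated_cover:
  assumes "splits X z1 z2 n m1 m2"
    and v: "lowest X z1 z2 v" "lowest X z2 z1 v" and "in_open_box z1 z2 xt xp v"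
  shows "objective_vector z1 z2 v \<in> new_points (objective_vector z1 z2 n)
           (objective_vector z1 z2 m1) (objective_vector z1 z2 m2) \<or>
         in_open_box z1 z2 m1 xp v \<or> in_open_box z1 z2 xt m2 v"
proof -
  note s = assms(1)[unfolded splits_def] and i = assms(4)[unfolded in_open_box_def]
  have m: "m1 \<in> X" "m2 \<in> X" and vX: "v \<in> X" using s v by (auto dest: lowest_in)
  consider "z1 v > z1 n" | "z2 v > z2 n" | "z1 v = z1 n" "z2 v \<le> z2 n" | "z2 v = z2 n" "z1 v \<le> z1 n"
    using s vX by (metis linorder_less_linear not_le_imp_less)
  then show ?thesis
  proof cases
    case 1
    then have "in_open_box z1 z2 m1 xp v"
      using s i lowestD[OF v(2) m(1)] unfolding in_open_box_def by force
    then show ?thesis by simp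
  next
    case 2
    then have "in_open_box z1 z2 xt m2 v"
      using s i lowestD[OF v(1) m(2)] unfolding in_open_box_def by force
    then show ?thesis by simp
  next
    case 3
    then have "z2 v = z2 m1"
      using s lowestD[OF v(1) m(1)] lowestD[of X z1 z2 m1 v] vX by force
    \<comment> \<open>If \<open>m1\<close> does not improve on \<open>n\<close>, then
      \<open>v\<close> has the image of \<open>n\<close>, and its nondominance rules out an
      improving \<open>m2\<close>, so \<open>n\<close> itself is a new point.\<close>
    then show ?thesis
      using 3 s lowestD[OF v(2) m(2)] unfolding new_points_objective_vector
      by (auto simp: objective_vector_eq_iff)
  next
    case 4
    then have "z1 v = z1 m2"
      using s lowestD[OF v(2) m(2)] lowestD[of X z2 z1 m2 v] vX by force
    then show ?thesis
      using 4 s lowestD[OF v(1) m(1)] unfolding new_points_objective_vector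
      by (auto simp: objective_vector_eq_iff)
  qed
qed

section \<open>The subproblems and their optimal solutions\<close>

locale biobjective =
  fixes X :: "'x set" and z1 z2 :: "'x \<Rightarrow> int" and d :: "real ^ 2" and \<epsilon> :: real
  assumes lexmin12: "\<exists>x. lexmin_solution X z1 z2 x"
    and lexmin21: "\<exists>x. lexmin_solution X z2 z1 x"
    and d_pos: "0 < d $ 1" "0 < d $ 2"
    and eps: "0 < \<epsilon>" "\<epsilon> < 1"
begin

abbreviation "obj \<equiv> objective_vector z1 z2"
abbreviation "corner \<equiv> corner_box z1 z2"

lemma le_minus_eps_iff: "real_of_int a \<le> real_of_int b - \<epsilon> \<longleftrightarrow> a < b"
  using eps by linarith

text \<open>The least \<open>\<alpha>\<close> compatible with \<open>x\<close> in \<open>R(b,d)\<close>.\<close>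

definition alpha :: "'x \<Rightarrow> 'x \<Rightarrow> 'x \<Rightarrow> real" where
  "alpha xt xp x = max ((z1 x - z1 xt) / d $ 1) ((z2 x - z2 xp) / d $ 2)"

text \<open>Dividing by the positive components of \<open>d\<close> turns the vector constraint into
  a lower bound on \<alpha>, and by integrality the slack \<open>\<epsilon>\<close> means strict
  inequality.\<close>

lemma R_feasible_iff:
  "R_feasible X z1 z2 d \<epsilon> (corner xt xp) (\<alpha>, x) \<longleftrightarrow>
     x \<in> X \<and> z1 x < z1 xp \<and> z2 x < z2 xt \<and> alpha xt xp x \<le> \<alpha>"
proof -
  have "alpha xt xp x \<le> \<alpha> \<longleftrightarrow> z1 x \<le> z1 xt + \<alpha> * d $ 1 \<and> z2 x \<le> z2 xp + \<alpha> * d $ 2"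
    using d_pos by (simp add: alpha_def pos_divide_le_eq) linarith
  then show ?thesis
    by (auto simp: R_feasible_def less_eq_vec_def forall_2 le_minus_eps_iff)
qed

text \<open>The problem \<open>R(b,d)\<close> bounds images only from above; the lower bounds come
  from the minimality of the two corners.\<close>

lemma feasible_in_open_box:
  assumes "lowest X z1 z2 xt" "lowest X z2 z1 xp" "x \<in> X" "z1 x < z1 xp" "z2 x < z2 xt"
  shows "in_open_box z1 z2 xt xp x"
  using assms lowestD[OF assms(1,3)] lowestD[OF assms(2,3)] unfolding in_open_box_def by force

lemma R_optimal_exists:
  assumes low: "lowest X z1 z2 xt" "lowest X z2 z1 xp"
    and "\<exists>q. R_feasible X z1 z2 d \<epsilon> (corner xt xp) q"
  shows "\<exists>q. R_optimal X z1 z2 d \<epsilon> (corner xt xp) q"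
proof -
  define P where "P x \<longleftrightarrow> x \<in> X \<and> z1 x < z1 xp \<and> z2 x < z2 xt" for x
  obtain a where "P a"
    using assms(3) by (auto simp: R_feasible_iff P_def)
  \<comment> \<open>The set \<open>X\<close> may be infinite, but the images of feasible points lie
    in a finite integer grid, so \<open>alpha\<close> takes finitely many values.\<close>
  have "alpha xt xp ` Collect P \<subseteq>
      (\<lambda>(u, v). max ((real_of_int u - z1 xt) / d $ 1) ((real_of_int v - z2 xp) / d $ 2)) `
        ({z1 xt..z1 xp} \<times> {z2 xp..z2 xt})"
  proof
    fix r assume "r \<in> alpha xt xp ` Collect P"
    then obtain x where x: "P x" "r = alpha xt xp x" by auto
    then have "(z1 x, z2 x) \<in> {z1 xt..z1 xp} \<times> {z2 xp..z2 xt}"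
      using feasible_in_open_box[OF low] by (auto simp: P_def in_open_box_def less_imp_le)
    then show "r \<in> (\<lambda>(u, v). max ((real_of_int u - z1 xt) / d $ 1) ((real_of_int v - z2 xp) / d $ 2)) `
        ({z1 xt..z1 xp} \<times> {z2 xp..z2 xt})"
      by (rule rev_image_eqI) (simp add: x alpha_def)
  qed
  then have "finite (alpha xt xp ` Collect P)"
    by (rule finite_subset) simp
  then obtain x where "is_arg_min (alpha xt xp) P x"
    using ex_is_arg_min_finite_image[of P, OF \<open>P a\<close>] by blast
  then have "R_optimal X z1 z2 d \<epsilon> (corner xt xp) (alpha xt xp x, x)"
    unfolding R_optimal_def is_arg_min_linorder
    by (auto simp: R_feasible_iff P_def intro: order_trans)
  then show ?thesis ..
qed

text \<open>A point bounded by \<open>n\<close> inherits the upper bounds of \<open>R(b,d)\<close>.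
  Were its image strictly below \<open>y\<close> in both coordinates, its \<open>alpha\<close> would
  be less than the optimal \<alpha>.\<close>

lemma R_optimal_below:
  assumes opt: "R_optimal X z1 z2 d \<epsilon> (corner xt xp) (\<alpha>, n)"
    and y: "y = s_pt (corner xt xp) + \<alpha> *\<^sub>R d"
  shows "n \<in> X" "z1 n < z1 xp" "z2 n < z2 xt" "z1 n \<le> y $ 1" "z2 n \<le> y $ 2"
    and "x \<in> X \<Longrightarrow> z1 x \<le> z1 n \<Longrightarrow> z2 x \<le> z2 n \<Longrightarrow> \<not> (z1 x < y $ 1 \<and> z2 x < y $ 2)"
proof -
  have feas: "R_feasible X z1 z2 d \<epsilon> (corner xt xp) (\<alpha>, n)"
    using opt by (simp add: R_optimal_def is_arg_min_linorder)
  then show n: "n \<in> X" "z1 n < z1 xp" "z2 n < z2 xt"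
    by (simp_all add: R_feasible_iff)
  show "z1 n \<le> y $ 1" "z2 n \<le> y $ 2"
    using feas by (simp_all add: R_feasible_def less_eq_vec_def forall_2 y)
  assume x: "x \<in> X" "z1 x \<le> z1 n" "z2 x \<le> z2 n"
  have "R_feasible X z1 z2 d \<epsilon> (corner xt xp) (alpha xt xp x, x)"
    using x n by (simp add: R_feasible_iff)
  then have "\<alpha> \<le> alpha xt xp x"
    using opt unfolding R_optimal_def is_arg_min_linorder by fastforce
  then show "\<not> (z1 x < y $ 1 \<and> z2 x < y $ 2)"
    using d_pos by (auto simp: y alpha_def le_max_iff_disj pos_le_divide_eq algebra_simps)
qed

text \<open>The second lexicographic problem provides a global lower bound on the integer-valued
  \<open>z2\<close>.\<close>

lemma P1_optimal_exists:
  assumes "x \<in> X"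
  shows "\<exists>u. P1_optimal X z1 z2 x u"
proof -
  obtain xp where "\<And>u. u \<in> X \<Longrightarrow> z2 xp \<le> z2 u"
    using lexmin21 unfolding lexmin_solution_iff by blast
  then show ?thesis
    unfolding P1_optimal_def using assms by (intro ex_is_arg_min_int[of _ x "z2 xp"]) simp_all
qed

lemma P2_optimal_exists:
  assumes "x \<in> X"
  shows "\<exists>u. P2_optimal X z1 z2 x u"
proof -
  obtain xt where "\<And>u. u \<in> X \<Longrightarrow> z1 xt \<le> z1 u"
    using lexmin12 unfolding lexmin_solution_iff by blast
  then show ?thesis
    unfolding P2_optimal_def using assms by (intro ex_is_arg_min_int[of _ x "z1 xt"]) simp_all
qed

lemma splits_of_optimal:
  assumes opt: "R_optimal X z1 z2 d \<epsilon> (corner xt xp) (\<alpha>, n)"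
    and y: "y = s_pt (corner xt xp) + \<alpha> *\<^sub>R d"
    and n1: "if y $ 1 = obj n $ 1
         then \<exists>x1. P1_optimal X z1 z2 n x1 \<and> n1 = obj x1 else n1 = obj n"
    and n2: "if y $ 2 = obj n $ 2
         then \<exists>x2. P2_optimal X z1 z2 n x2 \<and> n2 = obj x2 else n2 = obj n"
  obtains m1 m2 where "splits X z1 z2 n m1 m2" "n1 = obj m1" "n2 = obj m2"
proof -
  note R = R_optimal_below[OF opt y]
  obtain m1 where m1: "n1 = obj m1" "m1 \<in> X" "z1 m1 = z1 n" "z2 m1 \<le> z2 n"
      "y $ 1 = z1 n \<Longrightarrow> \<forall>x\<in>X. z1 x = z1 n \<longrightarrow> z2 m1 \<le> z2 x"
    using n1 R(1) by (auto simp: P1_optimal_def is_arg_min_linorder split: if_splits)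
  obtain m2 where m2: "n2 = obj m2" "m2 \<in> X" "z2 m2 = z2 n" "z1 m2 \<le> z1 n"
      "y $ 2 = z2 n \<Longrightarrow> \<forall>x\<in>X. z2 x = z2 n \<longrightarrow> z1 m2 \<le> z1 x"
    using n2 R(1) by (auto simp: P2_optimal_def is_arg_min_linorder split: if_splits)
  have "lowest X z1 z2 m1"
    by (rule lowest_of_optimal[of n _ _ "y $ 1" _ "y $ 2"]) (use R m1 in auto)
  moreover have "lowest X z2 z1 m2"
    by (rule lowest_of_optimal[of n _ _ "y $ 2" _ "y $ 1"]) (use R m2 in auto)
  \<comment> \<open>Since \<open>n\<close> is bounded by \<open>y\<close>, a point strictly below
    \<open>n\<close> would be strictly below \<open>y\<close>.\<close>
  moreover have "\<not> (z1 x < z1 n \<and> z2 x < z2 n)" if "x \<in> X" for x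
    using R(4,5) R(6)[OF that] by auto
  ultimately show ?thesis
    using that[of m1 m2] m1 m2 R(1) by (simp add: splits_def)
qed

section \<open>The invariant of a run and the decrease of the weight\<close>

definition invariant :: "state \<Rightarrow> bool" where
  "invariant S \<longleftrightarrow> (case S of (N, B) \<Rightarrow>
     finite B \<and> N \<subseteq> nondominated_points X z1 z2 \<and>
     (\<forall>b\<in>B. \<exists>xt xp. b = corner xt xp \<and> lowest X z1 z2 xt \<and> lowest X z2 z1 xp) \<and>
     (\<forall>v. lowest X z1 z2 v \<and> lowest X z2 z1 v \<longrightarrow>
        obj v \<in> N \<or> (\<exists>xt xp. corner xt xp \<in> B \<and> in_open_box z1 z2 xt xp v)))"

text \<open>The corners are extreme in \<open>z1\<close> and \<open>z2\<close>. A nondominated point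
  on the left or bottom edge therefore has the image of a corner; any other is incomparable to both
  corners and so lies in the interior.\<close>

lemma invariant_initial:
  assumes "initial_state X z1 z2 S"
  shows "invariant S"
proof -
  obtain xt xp where lex: "lexmin_solution X z1 z2 xt" "lexmin_solution X z2 z1 xp"
    and S: "S = ({obj xt, obj xp}, {corner xt xp})"
    using assms by (auto simp: initial_state_def Let_def corner_box_def)
  note low = lexmin_solution_lowest[OF lex(1)] lexmin_solution_lowest[OF lex(2)]
  have "obj v \<in> {obj xt, obj xp} \<or> in_open_box z1 z2 xt xp v"
    if v: "lowest X z1 z2 v" "lowest X z2 z1 v" for v
  proof -
    have X: "v \<in> X" "xt \<in> X" "xp \<in> X" using v low by (auto dest: lowest_in)
    have "z1 xt \<le> z1 v" "z2 xp \<le> z2 v"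
      using lex X unfolding lexmin_solution_iff by auto
    moreover have "z2 v = z2 xt" if "z1 v = z1 xt"
      using that lowestD[OF v(1) X(2)] lowestD[OF low(1) X(1)] by simp
    moreover have "z1 v = z1 xp" if "z2 v = z2 xp"
      using that lowestD[OF v(2) X(3)] lowestD[OF low(3) X(1)] by simp
    moreover have "z2 v < z2 xt" if "z1 xt < z1 v"
      using that lowestD[OF v(2) X(2)] by linarith
    moreover have "z1 v < z1 xp" if "z2 xp < z2 v"
      using that lowestD[OF v(1) X(3)] by linarith
    ultimately show ?thesis
      unfolding in_open_box_def by (auto simp: objective_vector_eq_iff order_le_less)
  qed
  then show ?thesis
    using low unfolding S invariant_def nondominated_points_eq_lowest by auto
qed

lemma step_invariant:
  assumes "step X z1 z2 d \<epsilon> S S'" and "invariant S"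
  shows "invariant S' \<and> weight (snd S') < weight (snd S)"
  using assms(1)
proof cases
  case (infeasible b B N)
  then have fin: "finite B" and b: "b \<in> B" using assms(2) by (auto simp: invariant_def)
  \<comment> \<open>An infeasible box has no feasible image in its interior, so removing it uncovers
    nothing.\<close>
  have empty: "b \<noteq> corner xt xp" if "in_open_box z1 z2 xt xp v" "v \<in> X" for xt xp v
  proof
    assume "b = corner xt xp"
    then have "R_feasible X z1 z2 d \<epsilon> b (alpha xt xp v, v)"
      using that by (simp add: R_feasible_iff in_open_box_def)
    then show False using infeasible(4) by blast
  qed
  have "obj v \<in> N \<or> (\<exists>xt xp. corner xt xp \<in> B - {b} \<and> in_open_box z1 z2 xt xp v)"
    if v: "lowest X z1 z2 v" "lowest X z2 z1 v" for v
    using assms(2) v empty[OF _ lowest_in[OF v(1)]] unfolding infeasible(1) invariant_def by blast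
  then have "invariant S'"
    using assms(2) unfolding infeasible(1,2) invariant_def by simp
  moreover have "weight (B - {b}) < weight B"
    using weight_remove[OF fin b] by simp
  ultimately show ?thesis using infeasible by simp
next
  case (feasible b B \<alpha> xb y n n1 n2 N)
  then have fin: "finite B" and b: "b \<in> B" and N: "N \<subseteq> nondominated_points X z1 z2"
    and cover: "\<And>v. lowest X z1 z2 v \<Longrightarrow> lowest X z2 z1 v \<Longrightarrow>
        obj v \<in> N \<or> (\<exists>xt xp. corner xt xp \<in> B \<and> in_open_box z1 z2 xt xp v)"
    and boxes: "\<And>b. b \<in> B \<Longrightarrow> \<exists>xt xp. b = corner xt xp \<and> lowest X z1 z2 xt \<and> lowest X z2 z1 xp"
    using assms(2) by (simp_all add: invariant_def)
  obtain xt xp where bx: "b = corner xt xp" and low: "lowest X z1 z2 xt" "lowest X z2 z1 xp"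
    using boxes[OF b] by auto
  obtain m1 m2 where sp: "splits X z1 z2 xb m1 m2" and n12: "n1 = obj m1" "n2 = obj m2"
    using splits_of_optimal feasible(4-8) unfolding bx by blast
  have R: "xb \<in> X" "z1 xb < z1 xp" "z2 xb < z2 xt"
    using R_optimal_below(1-3)[OF feasible(4)[unfolded bx] refl] by auto
  have ins: "in_open_box z1 z2 xt xp xb"
    using feasible_in_open_box low R by blast
  note sp' = sp[unfolded splits_def] and ins' = ins[unfolded in_open_box_def]
  let ?new = "new_boxes b n1 n2" and ?pts = "new_points n n1 n2"
  have new: "?new =
     (if z1 xp - z1 xb > 1 \<and> z2 m1 - z2 xp > 1 then {corner m1 xp} else {}) \<union>
     (if z1 m2 - z1 xt > 1 \<and> z2 xt - z2 xb > 1 then {corner xt m2} else {})"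
    using sp' unfolding bx n12 by (intro new_boxes_corner_box) auto
  \<comment> \<open>An integer strictly between two others forces a gap of at least 2, so the size
    tests discard only boxes without interior integer points.\<close>
  have new_box: "corner m1 xp \<in> ?new" if "in_open_box z1 z2 m1 xp v" for v
    using that sp' unfolding new in_open_box_def by auto
  have new_box': "corner xt m2 \<in> ?new" if "in_open_box z1 z2 xt m2 v" for v
    using that sp' unfolding new in_open_box_def by auto
  \<comment> \<open>Otherwise the final removal of \<open>b\<close> would delete a box just
    added.\<close>
  have ne: "corner m1 xp \<noteq> b" "corner xt m2 \<noteq> b"
    using sp' ins' by (auto simp: bx corner_box_eq_iff)
  have "obj v \<in> N \<union> ?pts \<or>
      (\<exists>xt xp. corner xt xp \<in> (B \<union> ?new) - {b} \<and> in_open_box z1 z2 xt xp v)"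
    if v: "lowest X z1 z2 v" "lowest X z2 z1 v" for v
  proof (cases "in_open_box z1 z2 xt xp v")
    case True
    then have "obj v \<in> ?pts \<or> in_open_box z1 z2 m1 xp v \<or> in_open_box z1 z2 xt m2 v"
      using nondominated_cover[OF sp v] feasible(6) n12 by simp
    then show ?thesis using new_box new_box' ne by blast
  next
    case False
    \<comment> \<open>Other preimages of the same corners describe the same interior, so a box
      covering \<open>v\<close> is not the one removed.\<close>
    then have "corner ut up \<noteq> b" if "in_open_box z1 z2 ut up v" for ut up
      using that by (auto simp: bx corner_box_eq_iff in_open_box_def)
    then show ?thesis using cover[OF v] by blast
  qed
  moreover have "\<exists>xt xp. c = corner xt xp \<and> lowest X z1 z2 xt \<and> lowest X z2 z1 xp"
    if "c \<in> (B \<union> ?new) - {b}" for c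
    using that boxes low sp' unfolding new by (auto split: if_splits)
  moreover have "?pts \<subseteq> nondominated_points X z1 z2"
    using new_points_nondominated[OF sp] feasible(6) n12 by simp
  moreover have finnew: "finite ?new" unfolding new by simp
  ultimately have inv: "invariant S'"
    using fin N unfolding feasible(2) invariant_def by simp
  \<comment> \<open>The image of \<open>xb\<close> is an interior point, so the width is
    positive.\<close>
  obtain w where w: "width b = Suc w"
    using ins' by (cases "width b") (auto simp: bx)
  have narrow: "width c \<le> w" if "c \<in> ?new" for c
  proof -
    have "z1 xp - z1 m1 < z1 xp - z1 xt" "z1 m2 - z1 xt < z1 xp - z1 xt"
      using sp' ins' by auto
    then have "width c < width b"
      using that[unfolded new] ins' unfolding bx by (auto split: if_splits)
    then show ?thesis using w by simp
  qed
  have "card ?new \<le> 2" unfolding new by (auto simp: card_insert_if)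
  have "weight ?new \<le> card ?new * 3 ^ w"
    unfolding weight_def using narrow
    by (intro sum_bounded_above[where 'a = nat, simplified]) (simp add: power_increasing)
  also have "\<dots> \<le> 2 * 3 ^ w" using \<open>card ?new \<le> 2\<close> by simp
  also have "\<dots> < 3 ^ width b" by (simp add: w)
  finally have "weight ?new < 3 ^ width b" .
  moreover have "(B \<union> ?new) - {b} = (B - {b}) \<union> ?new"
    using ne unfolding new by auto
  ultimately have "weight ((B \<union> ?new) - {b}) < weight B"
    using weight_Un_le[of "B - {b}" ?new] fin finnew weight_remove[OF fin b] by simp
  then show ?thesis using inv feasible by simp
qed

section \<open>Termination, progress and the returned set\<close>

lemma invariant_reachable: "reachable X z1 z2 d \<epsilon> S \<Longrightarrow> invariant S"
proof -
  have "(step X z1 z2 d \<epsilon>)\<^sup>*\<^sup>* S0 S \<Longrightarrow> invariant S0 \<Longrightarrow> invariant S" for S0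
    by (induction rule: rtranclp_induct) (auto dest: step_invariant)
  then show "reachable X z1 z2 d \<epsilon> S \<Longrightarrow> invariant S"
    by (auto simp: reachable_def dest: invariant_initial)
qed

lemma terminates: "terminates X z1 z2 d \<epsilon>"
  unfolding terminates_def
proof
  assume "\<exists>\<sigma>. initial_state X z1 z2 (\<sigma> 0) \<and> (\<forall>k. step X z1 z2 d \<epsilon> (\<sigma> k) (\<sigma> (Suc k)))"
  then obtain \<sigma> where init: "initial_state X z1 z2 (\<sigma> 0)"
    and run: "\<And>k. step X z1 z2 d \<epsilon> (\<sigma> k) (\<sigma> (Suc k))" by auto
  have "invariant (\<sigma> k)" for k
    by (induction k) (simp_all add: invariant_initial[OF init] step_invariant[OF run])
  then have "weight (snd (\<sigma> (Suc k))) < weight (snd (\<sigma> k))" for k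
    using step_invariant[OF run] by simp
  then show False
    using wf_no_infinite_down_chainE[OF wf_less_than, of "\<lambda>k. weight (snd (\<sigma> k))"] by auto
qed

lemma solvable:
  assumes "invariant (N, B)" "b \<in> B"
  shows "(\<exists>q. R_feasible X z1 z2 d \<epsilon> b q) \<Longrightarrow> (\<exists>q. R_optimal X z1 z2 d \<epsilon> b q)"
    and "R_optimal X z1 z2 d \<epsilon> b (\<alpha>, xb) \<Longrightarrow> \<exists>x1. P1_optimal X z1 z2 xb x1"
    and "R_optimal X z1 z2 d \<epsilon> b (\<alpha>, xb) \<Longrightarrow> \<exists>x2. P2_optimal X z1 z2 xb x2"
proof -
  obtain xt xp where b: "b = corner xt xp" and low: "lowest X z1 z2 xt" "lowest X z2 z1 xp"
    using assms by (auto simp: invariant_def)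
  show "(\<exists>q. R_feasible X z1 z2 d \<epsilon> b q) \<Longrightarrow> (\<exists>q. R_optimal X z1 z2 d \<epsilon> b q)"
    using R_optimal_exists[OF low] b by simp
  assume "R_optimal X z1 z2 d \<epsilon> b (\<alpha>, xb)"
  then have "xb \<in> X" using R_optimal_below(1) b by blast
  then show "\<exists>x1. P1_optimal X z1 z2 xb x1" "\<exists>x2. P2_optimal X z1 z2 xb x2"
    by (rule P1_optimal_exists P2_optimal_exists)+
qed

lemma progress:
  assumes "invariant (N, B)" "b \<in> B"
  shows "\<exists>S'. step X z1 z2 d \<epsilon> (N, B) S'"
proof (cases "\<exists>q. R_feasible X z1 z2 d \<epsilon> b q")
  case False
  then show ?thesis using step.infeasible[OF assms(2)] by blast
next
  case True
  then obtain \<alpha> xb where opt: "R_optimal X z1 z2 d \<epsilon> b (\<alpha>, xb)"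
    using solvable(1)[OF assms] by auto
  define y where "y = s_pt b + \<alpha> *\<^sub>R d"
  have "\<exists>n1. if y $ 1 = obj xb $ 1
         then \<exists>x1. P1_optimal X z1 z2 xb x1 \<and> n1 = obj x1 else n1 = obj xb"
    using solvable(2)[OF assms opt] by auto
  moreover have "\<exists>n2. if y $ 2 = obj xb $ 2
         then \<exists>x2. P2_optimal X z1 z2 xb x2 \<and> n2 = obj x2 else n2 = obj xb"
    using solvable(3)[OF assms opt] by auto
  ultimately show ?thesis
    using step.feasible[OF assms(2) opt y_def refl] by blast
qed

text \<open>Induction on the weight: with boxes left, \<open>progress\<close> extends the run, and
  the step lowers the weight.\<close>

lemma some_run_returns: "\<exists>N. returns X z1 z2 d \<epsilon> N"
proof -
  have "\<exists>N. returns X z1 z2 d \<epsilon> N" if "reachable X z1 z2 d \<epsilon> S" for S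
    using that
  proof (induction "weight (snd S)" arbitrary: S rule: less_induct)
    case less
    obtain N B where S: "S = (N, B)" by (cases S)
    show ?case
    proof (cases "B = {}")
      case True
      then show ?thesis using less.prems S by (auto simp: returns_def)
    next
      case False
      note inv = invariant_reachable[OF less.prems]
      obtain S' where S': "step X z1 z2 d \<epsilon> S S'"
        using progress inv False unfolding S by blast
      then have "reachable X z1 z2 d \<epsilon> S'"
        using less.prems unfolding reachable_def by (meson rtranclp.rtrancl_into_rtrancl)
      then show ?thesis
        using less.hyps step_invariant[OF S' inv] by blast
    qed
  qed
  moreover have "\<exists>S. initial_state X z1 z2 S"
    using lexmin12 lexmin21 unfolding initial_state_def Let_def by blast
  ultimately show ?thesis unfolding reachable_def by blast
qed

lemma subproblems_solvable: "subproblems_solvable X z1 z2 d \<epsilon>"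
  unfolding subproblems_solvable_def
proof (intro allI impI)
  fix N B b assume "reachable X z1 z2 d \<epsilon> (N, B)" and b: "b \<in> B"
  then have inv: "invariant (N, B)" by (simp add: invariant_reachable)
  show "((\<exists>q. R_feasible X z1 z2 d \<epsilon> b q) \<longrightarrow> (\<exists>q. R_optimal X z1 z2 d \<epsilon> b q)) \<and>
      (\<forall>\<alpha> xb. R_optimal X z1 z2 d \<epsilon> b (\<alpha>, xb) \<longrightarrow>
         ((s_pt b + \<alpha> *\<^sub>R d) $ 1 = obj xb $ 1 \<longrightarrow> (\<exists>x1. P1_optimal X z1 z2 xb x1)) \<and>
         ((s_pt b + \<alpha> *\<^sub>R d) $ 2 = obj xb $ 2 \<longrightarrow> (\<exists>x2. P2_optimal X z1 z2 xb x2)))"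
    using solvable(1)[OF inv b] solvable(2)[OF inv b] solvable(3)[OF inv b] by meson
qed

text \<open>With no box left, the covering clause of the invariant puts every nondominated point
  into the output.\<close>

lemma returns_nondominated_points:
  assumes "returns X z1 z2 d \<epsilon> N"
  shows "N = nondominated_points X z1 z2"
proof -
  have "invariant (N, {})"
    using assms unfolding returns_def by (rule invariant_reachable)
  then show ?thesis
    unfolding invariant_def by (auto simp: nondominated_points_eq_lowest)
qed

lemma works_correctly: "works_correctly X z1 z2 d \<epsilon>"
  unfolding works_correctly_def
  using terminates subproblems_solvable some_run_returns returns_nondominated_points by simp

end

theorem proposition3p2:
  fixes X :: "(int ^ 'n::finite) set"
    and z1 z2 :: "int ^ 'n \<Rightarrow> int"
    and d :: "real ^ 2"
    and \<epsilon> :: real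
  assumes "X \<noteq> {}"
    and "\<exists>x. lexmin_solution X z1 z2 x"
    and "\<exists>x. lexmin_solution X z2 z1 x"
    and "0 \<le> d" and "d \<noteq> 0"
    \<comment> \<open>Not in the source. Without it the claim fails: if \<open>d $ 1 = 0\<close> or \<open>d $ 2 = 0\<close>, then
      \<open>R(b,d)\<close> is infeasible for the initial box and only its two corners are returned.\<close>
    and interior_direction: "d $ 1 \<noteq> 0" "d $ 2 \<noteq> 0"
    and "0 < \<epsilon>" and "\<epsilon> < 1"
  shows "works_correctly X z1 z2 d \<epsilon>"
proof -
  have "0 < d $ 1" "0 < d $ 2"
    using \<open>0 \<le> d\<close> interior_direction by (auto simp: less_eq_vec_def order_less_le)
  then interpret biobjective X z1 z2 d \<epsilon>
    using assms by unfold_locales auto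
  show ?thesis by (rule works_correctly)
qed

end
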